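(* Let $n\ge 1$ and let $T\in\mathbb{R}^{n\times n}$ be a unit upper triangular matrix, i.e. $T_{i,i}=1$ for all $i$ and $T_{i,j}=0$ for $i>j$ (the entries $T_{i,j}$ with $j>i$ being arbitrary). For $1\le i<j\le n$ enumerate the Hopscotch series $\mathcal{H}(i,j)$ as its sequences number $k=1,\dots,2^{j-i-1}$; let $\ell_\star^{k}$ denote the length (number of terms) of the $k$-th sequence of $\mathcal{H}(i,j)$ and $\alpha^{k}_{\ell}$ its $\ell$-th term, so that the $k$-th sequence is $\langle \alpha^k_1,\dots,\alpha^k_{\ell_\star^k}\rangle$ with $\alpha^k_1=i$ and $\alpha^k_{\ell_\star^k}=j$. Then the inverse matrix $S=T^{-1}$ is given by $$S_{i,j}=\begin{cases}\displaystyle\sum_{k=1}^{2^{\,j-i-1}}(-1)^{\ell_\star^{k}-1}\prod_{\ell=1}^{\ell_\star^{k}-1}T_{\alpha^{k}_{\ell},\,\alpha^{k}_{\ell+1}} & \text{if } j>i,\\[2mm] 1 & \text{if } i=j,\\ 0 & \text{otherwise.}\end{cases}$$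
   Context: For integers $0<a<b$, the Hopscotch series $\mathcal{H}(a,b)$ is the collection of all strictly increasing integer sequences whose first term is $a$ and whose last term is $b$; equivalently, all sequences obtained from the complete sequence $\langle a,a+1,\dots,b\rangle$ by deleting an arbitrary (possibly empty) subset of the integers strictly between $a$ and $b$. For example, $\mathcal{H}(1,4)$ consists of $\langle 1,2,3,4\rangle$, $\langle 1,3,4\rangle$, $\langle 1,2,4\rangle$, $\langle 1,4\rangle$. There are $2^{b-a-1}$ such sequences. *)

theory Defs
  imports "Jordan_Normal_Form.Matrix"
begin

text \<open>
  The sequences are lists of natural numbers; for positive \<open>a\<close> every strictly increasing
  integer sequence that starts at \<open>a\<close> consists of naturals.
\<close>

definition hopscotch :: "nat \<Rightarrow> nat \<Rightarrow> nat list set" where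
  "hopscotch a b = {s. s \<noteq> [] \<and> sorted_wrt (<) s \<and> hd s = a \<and> last s = b}"

text \<open>
  \<open>Matrix\<close> and \<open>List\<close> count rows, columns and positions from 0; the following two
  accessors count from 1.
\<close>

definition entry :: "'a mat \<Rightarrow> nat \<Rightarrow> nat \<Rightarrow> 'a" where
  "entry A i j = A $$ (i - 1, j - 1)"

definition seq_term :: "nat list \<Rightarrow> nat \<Rightarrow> nat" where
  "seq_term s l = s ! (l - 1)"

definition unit_upper_triangular :: "'a::{zero,one} mat \<Rightarrow> bool" where
  "unit_upper_triangular A \<longleftrightarrow> upper_triangular A \<and> (\<forall>i < dim_row A. A $$ (i, i) = 1)"

definition hopscotch_enumeration :: "nat \<Rightarrow> nat \<Rightarrow> (nat \<Rightarrow> nat list) \<Rightarrow> bool" where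
  "hopscotch_enumeration a b \<alpha> \<longleftrightarrow> bij_betw \<alpha> {1..2 ^ (b - a - 1)} (hopscotch a b)"

lemma sorted_hd_last_bounds:
  fixes s :: "nat list"
  assumes "sorted s" and "x \<in> set s"
  shows "hd s \<le> x" and "x \<le> last s"
proof -
  from assms(2) obtain i where i: "i < length s" "x = s ! i" by (auto simp: in_set_conv_nth)
  then have "s \<noteq> []" by auto
  with i show "hd s \<le> x" "x \<le> last s"
    using sorted_nth_mono[OF assms(1), of 0 i] sorted_nth_mono[OF assms(1), of i "length s - 1"]
    by (simp_all add: hd_conv_nth last_conv_nth)
qed

text \<open>
  The sequences of \<open>hopscotch a b\<close> correspond to the sets of retained intermediate integers;
  hence there are \<open>2 ^ (b - a - 1)\<close> of them and an enumeration exists.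
\<close>

lemma hopscotch_bij_betw_Pow:
  assumes "a < b"
  shows "bij_betw (\<lambda>X. sorted_list_of_set (insert a (insert b X))) (Pow {a<..<b}) (hopscotch a b)"
proof (rule bij_betw_byWitness[where f' = "\<lambda>s. set s - {a, b}"])
  have bounds: "a \<in> set s \<and> b \<in> set s \<and> set s \<subseteq> {a..b}" if "s \<in> hopscotch a b" for s
  proof -
    from that have s: "s \<noteq> []" "sorted s" "hd s = a" "last s = b"
      by (auto simp: hopscotch_def strict_sorted_iff)
    then show ?thesis
      using sorted_hd_last_bounds[OF s(2)] hd_in_set[OF s(1)] last_in_set[OF s(1)] by auto
  qed
  show "\<forall>X\<in>Pow {a<..<b}. set (sorted_list_of_set (insert a (insert b X))) - {a, b} = X"
  proof
    fix X assume X: "X \<in> Pow {a<..<b}"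
    then have "finite (insert a (insert b X))" by (auto intro: finite_subset)
    with X show "set (sorted_list_of_set (insert a (insert b X))) - {a, b} = X"
      by (subst set_sorted_list_of_set) auto
  qed
  show "\<forall>s\<in>hopscotch a b. sorted_list_of_set (insert a (insert b (set s - {a, b}))) = s"
  proof
    fix s assume s: "s \<in> hopscotch a b"
    have "insert a (insert b (set s - {a, b})) = set s" using bounds[OF s] by blast
    moreover have "sorted s" "distinct s"
      using s by (auto simp: hopscotch_def strict_sorted_iff)
    ultimately show "sorted_list_of_set (insert a (insert b (set s - {a, b}))) = s"
      by (simp add: sorted_list_of_set.idem_if_sorted_distinct)
  qed
  show "(\<lambda>X. sorted_list_of_set (insert a (insert b X))) ` Pow {a<..<b} \<subseteq> hopscotch a b"
  proof (rule image_subsetI)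
    fix X assume "X \<in> Pow {a<..<b}"
    then have X: "X \<subseteq> {a<..<b}" "finite X" by (auto intro: finite_subset)
    define ys where "ys = sorted_list_of_set (insert a (insert b X))"
    have set: "set ys = insert a (insert b X)"
      unfolding ys_def using X by (subst set_sorted_list_of_set) auto
    then have ne: "ys \<noteq> []" by auto
    have strict: "sorted_wrt (<) ys" unfolding ys_def by (rule strict_sorted_list_of_set)
    then have "sorted ys" by (simp add: strict_sorted_iff)
    note bounds = sorted_hd_last_bounds[OF this]
    have "\<forall>x \<in> set ys. a \<le> x \<and> x \<le> b" using set X assms by auto
    then have "a \<le> hd ys" "last ys \<le> b" using ne by auto
    moreover have "hd ys \<le> a" "b \<le> last ys" using set bounds by auto
    ultimately have "ys \<in> hopscotch a b" using ne strict by (auto simp: hopscotch_def)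
    then show "sorted_list_of_set (insert a (insert b X)) \<in> hopscotch a b"
      by (simp only: ys_def)
  qed
  show "(\<lambda>s. set s - {a, b}) ` hopscotch a b \<subseteq> Pow {a<..<b}"
  proof (rule image_subsetI, rule PowI, rule subsetI)
    fix s x assume "s \<in> hopscotch a b" "x \<in> set s - {a, b}"
    then show "x \<in> {a<..<b}" using bounds[of s] by (auto simp: le_less)
  qed
qed

lemma card_hopscotch:
  assumes "a < b"
  shows "finite (hopscotch a b)" and "card (hopscotch a b) = 2 ^ (b - a - 1)"
  using bij_betw_same_card[OF hopscotch_bij_betw_Pow[OF assms]]
    bij_betw_finite[OF hopscotch_bij_betw_Pow[OF assms]]
  by (simp_all add: card_Pow)

lemma hopscotch_enumeration_exists:
  assumes "a < b"
  shows "\<exists>\<alpha>. hopscotch_enumeration a b \<alpha>"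
  unfolding hopscotch_enumeration_def
  using card_hopscotch[OF assms] by (intro finite_same_card_bij) auto

end

theory Submission
  imports Defs "Jordan_Normal_Form.Determinant"
begin

text \<open>
  Let \<open>U i j\<close> be the signed sum over all hopscotch sequences from \<open>i\<close> to \<open>j\<close>. Splitting the
  sequences by their second term \<open>k\<close> gives \<open>U i j = - (\<Sum>k = i + 1..j. T i k * U k j)\<close> for
  \<open>i < j\<close>. Since \<open>T i i = 1\<close>, this is the vanishing of the entry \<open>(i, j)\<close> of \<open>T U\<close>.
\<close>

text \<open>The factors are arranged as in the theorem's summand, so unfolding alone identifies the
  two. A function \<open>f\<close> in place of a matrix keeps the combinatorics free of index
  bounds.\<close>

definition path_weight :: "(nat \<Rightarrow> nat \<Rightarrow> 'a::comm_ring_1) \<Rightarrow> nat list \<Rightarrow> 'a" where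
  "path_weight f s =
    (- 1) ^ (length s - 1) * (\<Prod>l = 1..length s - 1. f (seq_term s l) (seq_term s (l + 1)))"

text \<open>This is the entry at \<open>i\<close>, \<open>j\<close> of the geometric series of
  \<open>-N\<close>, where \<open>N\<close> is the strictly upper triangular part of
  \<open>f\<close>; a sequence with \<open>m\<close> steps contributes to the power
  \<open>m\<close>.\<close>

definition hopscotch_sum :: "(nat \<Rightarrow> nat \<Rightarrow> 'a::comm_ring_1) \<Rightarrow> nat \<Rightarrow> nat \<Rightarrow> 'a" where
  "hopscotch_sum f i j = (\<Sum>s \<in> hopscotch i j. path_weight f s)"

lemma path_weight_singleton [simp]: "path_weight f [a] = 1"
  by (simp add: path_weight_def)

text \<open>The new first step contributes one factor of the product and one change of sign.\<close>

lemma path_weight_Cons: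
  assumes "s \<noteq> []"
  shows "path_weight f (a # s) = - f a (hd s) * path_weight f s"
proof -
  from assms obtain m where m: "length s = Suc m" by (cases s) auto
  have "(\<Prod>l = 1..Suc m. f (seq_term (a # s) l) (seq_term (a # s) (l + 1))) =
      f a (hd s) * (\<Prod>l = Suc 1..Suc m. f (seq_term (a # s) l) (seq_term (a # s) (l + 1)))"
    using assms by (subst prod.atLeast_Suc_atMost) (simp_all add: seq_term_def hd_conv_nth)
  also have "(\<Prod>l = Suc 1..Suc m. f (seq_term (a # s) l) (seq_term (a # s) (l + 1))) =
      (\<Prod>l = 1..m. f (seq_term s l) (seq_term s (l + 1)))"
    unfolding prod.atLeast_Suc_atMost_Suc_shift
    by (rule prod.cong) (auto simp: seq_term_def nth_Cons')
  finally show ?thesis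
    using m by (simp add: path_weight_def)
qed

lemma hopscotch_imp_le:
  assumes "s \<in> hopscotch a b"
  shows "a \<le> b"
proof -
  have "sorted s" "s \<noteq> []" "hd s = a" "last s = b"
    using assms by (auto simp: hopscotch_def strict_sorted_iff)
  then show ?thesis
    using sorted_hd_last_bounds(1)[of s b] last_in_set[of s] by simp
qed

text \<open>A second term would force the last term to exceed the first.\<close>

lemma hopscotch_self: "hopscotch a a = {[a]}"
proof -
  have "s = [a]" if s: "s \<in> hopscotch a a" for s
  proof (cases s)
    case (Cons x t)
    then show ?thesis
      using s last_in_set[of t] by (cases "t = []") (auto simp: hopscotch_def)
  qed (use s in \<open>simp add: hopscotch_def\<close>)
  then show ?thesis
    by (auto simp: hopscotch_def)
qed

lemma finite_hopscotch: "finite (hopscotch a b)"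
proof (cases a b rule: linorder_cases)
  case less
  then show ?thesis by (rule card_hopscotch(1))
next
  case equal
  then show ?thesis by (simp add: hopscotch_self)
next
  case greater
  then have "hopscotch a b = {}" using hopscotch_imp_le[of _ a b] by fastforce
  then show ?thesis by simp
qed

text \<open>Deleting the first term leaves a sequence that starts at the second term
  \<open>k\<close>; \<open>a < b\<close> ensures that a second term exists.\<close>

lemma hopscotch_unfold:
  assumes "a < b"
  shows "hopscotch a b = (\<Union>k \<in> {a<..b}. (#) a ` hopscotch k b)"
proof (rule subset_antisym; rule subsetI)
  fix s assume s: "s \<in> hopscotch a b"
  then obtain t where t: "s = a # t" by (cases s) (auto simp: hopscotch_def)
  with s assms have "t \<noteq> []" by (auto simp: hopscotch_def)
  with s t have "a < hd t" "t \<in> hopscotch (hd t) b" by (auto simp: hopscotch_def)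
  moreover from this have "hd t \<le> b" by (auto dest: hopscotch_imp_le)
  ultimately show "s \<in> (\<Union>k \<in> {a<..b}. (#) a ` hopscotch k b)" using t by auto
next
  fix s assume "s \<in> (\<Union>k \<in> {a<..b}. (#) a ` hopscotch k b)"
  then obtain k t where kt: "a < k" "s = a # t" "t \<in> hopscotch k b" by auto
  then have "sorted t" and *: "t \<noteq> []" "sorted_wrt (<) t" "hd t = k" "last t = b"
    by (auto simp: hopscotch_def strict_sorted_iff)
  \<comment> \<open>The head \<open>k\<close> is the least term of \<open>t\<close>, so
    \<open>a < k\<close> suffices for prepending \<open>a\<close>.\<close>
  then have "\<forall>x \<in> set t. a < x"
    using sorted_hd_last_bounds(1)[of t] kt(1) by fastforce
  with * kt(2) show "s \<in> hopscotch a b" by (simp add: hopscotch_def)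
qed

lemma hopscotch_sum_self [simp]: "hopscotch_sum f i i = 1"
  by (simp add: hopscotch_sum_def hopscotch_self)

lemma hopscotch_sum_eq_0:
  assumes "j < i"
  shows "hopscotch_sum f i j = 0"
  using assms hopscotch_imp_le[of _ i j] unfolding hopscotch_sum_def
  by (intro sum.neutral) fastforce

lemma hopscotch_sum_rec:
  assumes "i < j"
  shows "hopscotch_sum f i j = - (\<Sum>k \<in> {i<..j}. f i k * hopscotch_sum f k j)"
proof -
  have "hopscotch_sum f i j = (\<Sum>k \<in> {i<..j}. \<Sum>s \<in> (#) i ` hopscotch k j. path_weight f s)"
    unfolding hopscotch_sum_def hopscotch_unfold[OF assms]
    \<comment> \<open>The union is disjoint because a sequence determines its second term
      \<open>k\<close>.\<close>
    by (rule sum.UNION_disjoint) (simp_all add: finite_hopscotch, auto simp: hopscotch_def)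
  also have "\<dots> = (\<Sum>k \<in> {i<..j}. - (f i k * hopscotch_sum f k j))"
  proof (rule sum.cong)
    fix k
    have "(\<Sum>s \<in> (#) i ` hopscotch k j. path_weight f s) =
        (\<Sum>s \<in> hopscotch k j. path_weight f (i # s))"
      by (simp add: sum.reindex)
    also have "\<dots> = (\<Sum>s \<in> hopscotch k j. - f i k * path_weight f s)"
      by (rule sum.cong) (auto simp: path_weight_Cons hopscotch_def)
    finally show "(\<Sum>s \<in> (#) i ` hopscotch k j. path_weight f s) = - (f i k * hopscotch_sum f k j)"
      by (simp add: hopscotch_sum_def sum_distrib_left sum_negf)
  qed simp
  finally show ?thesis by (simp add: sum_negf)
qed

lemma sum_mult_hopscotch_sum:
  assumes diag: "f i i = 1" and lower: "\<And>k. 1 \<le> k \<Longrightarrow> k < i \<Longrightarrow> f i k = 0"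
    and "1 \<le> i" "j \<le> n"
  shows "(\<Sum>k = 1..n. f i k * hopscotch_sum f k j) = (if i = j then 1 else 0)"
proof -
  have "(\<Sum>k = 1..n. f i k * hopscotch_sum f k j) = (\<Sum>k = i..j. f i k * hopscotch_sum f k j)"
    \<comment> \<open>Terms with \<open>k < i\<close> vanish because \<open>f\<close> is zero there,
      terms with \<open>k > j\<close> because no increasing sequence leads from \<open>k\<close> to
      \<open>j\<close>.\<close>
    using assms by (intro sum.mono_neutral_right) (auto simp: lower hopscotch_sum_eq_0 not_le)
  also have "\<dots> = (if i = j then 1 else 0)"
  proof (cases "i < j")
    case True
    then have "(\<Sum>k = i..j. f i k * hopscotch_sum f k j) =
        hopscotch_sum f i j + (\<Sum>k \<in> {i<..j}. f i k * hopscotch_sum f k j)"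
      by (simp add: sum.head diag)
    \<comment> \<open>The recursion makes the diagonal term cancel the remaining sum.\<close>
    with True show ?thesis by (simp add: hopscotch_sum_rec)
  \<comment> \<open>For \<open>i = j\<close> a single term 1 remains; for \<open>j < i\<close> the
    range is empty.\<close>
  qed (use diag in auto)
  finally show ?thesis .
qed

text \<open>\<open>Suc\<close> translates matrix positions, counted from 0, to the indices from 1
  used by \<open>entry\<close>.\<close>

definition hopscotch_mat :: "'a::comm_ring_1 mat \<Rightarrow> 'a mat" where
  "hopscotch_mat T =
    mat (dim_row T) (dim_row T) (\<lambda>(i, j). hopscotch_sum (entry T) (Suc i) (Suc j))"

lemma mult_hopscotch_mat:
  assumes "T \<in> carrier_mat n n" "unit_upper_triangular T"
  shows "T * hopscotch_mat T = 1\<^sub>m n"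
proof (rule eq_matI)
  fix i j assume "i < dim_row (1\<^sub>m n)" "j < dim_col (1\<^sub>m n)"
  then have ij: "i < n" "j < n" by auto
  have "(T * hopscotch_mat T) $$ (i, j) =
      (\<Sum>k = 0..<n. entry T (Suc i) (Suc k) * hopscotch_sum (entry T) (Suc k) (Suc j))"
    using assms ij by (simp add: hopscotch_mat_def scalar_prod_def entry_def)
  also have "\<dots> = (\<Sum>k = 1..n. entry T (Suc i) k * hopscotch_sum (entry T) k (Suc j))"
    by (simp flip: atLeastLessThanSuc_atLeastAtMost add: sum.shift_bounds_Suc_ivl del: sum.op_ivl_Suc)
  also have "\<dots> = (if Suc i = Suc j then 1 else 0)"
    using assms ij
    by (intro sum_mult_hopscotch_sum)
      (auto simp: entry_def unit_upper_triangular_def upper_triangular_def)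
  finally show "(T * hopscotch_mat T) $$ (i, j) = 1\<^sub>m n $$ (i, j)"
    using ij by simp
qed (use assms in \<open>auto simp: hopscotch_mat_def\<close>)

text \<open>Reindexing along the bijection shows that the sum does not depend on the chosen
  enumeration.\<close>

lemma sum_hopscotch_enumeration:
  assumes "hopscotch_enumeration i j \<alpha>"
  shows "(\<Sum>k = 1..2 ^ (j - i - 1). path_weight f (\<alpha> k)) = hopscotch_sum f i j"
  using assms unfolding hopscotch_enumeration_def hopscotch_sum_def
  by (rule sum.reindex_bij_betw)

theorem theorem3p3:
  fixes n :: nat and T :: "real mat" and \<alpha> :: "nat \<Rightarrow> nat \<Rightarrow> nat \<Rightarrow> nat list"
  assumes "n \<ge> 1"
    and "T \<in> carrier_mat n n"
    and "unit_upper_triangular T"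
    and "\<And>i j. 1 \<le> i \<Longrightarrow> i < j \<Longrightarrow> j \<le> n \<Longrightarrow> hopscotch_enumeration i j (\<alpha> i j)"
  shows "invertible_mat T \<and>
    (\<forall>S \<in> carrier_mat n n. inverts_mat T S \<and> inverts_mat S T \<longrightarrow>
      (\<forall>i \<in> {1..n}. \<forall>j \<in> {1..n}.
        entry S i j =
          (if i < j then
             (\<Sum>k = 1..2 ^ (j - i - 1).
                (- 1) ^ (length (\<alpha> i j k) - 1) *
                (\<Prod>l = 1..length (\<alpha> i j k) - 1.
                   entry T (seq_term (\<alpha> i j k) l) (seq_term (\<alpha> i j k) (l + 1))))
           else if i = j then 1
           else 0)))"
proof (intro conjI ballI impI)
  have U: "hopscotch_mat T \<in> carrier_mat n n"
    using assms(2) by (simp add: hopscotch_mat_def)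
  have TU: "T * hopscotch_mat T = 1\<^sub>m n"
    using assms(2,3) by (rule mult_hopscotch_mat)
  \<comment> \<open>For square matrices over a field a right inverse is also a left inverse.\<close>
  have UT: "hopscotch_mat T * T = 1\<^sub>m n"
    using mat_mult_left_right_inverse[OF assms(2) U TU] .
  show "invertible_mat T"
    using assms(2) U TU UT unfolding invertible_mat_def inverts_mat_def
    by (auto intro!: exI[of _ "hopscotch_mat T"])
  fix S i j
  assume S: "S \<in> carrier_mat n n" "inverts_mat T S \<and> inverts_mat S T"
    and ij: "i \<in> {1..n}" "j \<in> {1..n}"
  \<comment> \<open>Uniqueness of inverses: \<open>S\<close> is a left inverse and
    \<open>hopscotch_mat T\<close> a right inverse of \<open>T\<close>.\<close>
  have "S = S * (T * hopscotch_mat T)" using S TU by simp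
  also have "\<dots> = S * T * hopscotch_mat T"
    using assoc_mult_mat[OF S(1) assms(2) U] by simp
  also have "\<dots> = hopscotch_mat T" using S U by (simp add: inverts_mat_def)
  finally have "entry S i j = hopscotch_sum (entry T) i j"
    using ij assms(2) by (auto simp: entry_def hopscotch_mat_def)
  then show "entry S i j =
      (if i < j then
         (\<Sum>k = 1..2 ^ (j - i - 1).
            (- 1) ^ (length (\<alpha> i j k) - 1) *
            (\<Prod>l = 1..length (\<alpha> i j k) - 1.
               entry T (seq_term (\<alpha> i j k) l) (seq_term (\<alpha> i j k) (l + 1))))
       else if i = j then 1
       else 0)"
    \<comment> \<open>The enumeration is available only for \<open>i < j\<close>; the other two
      cases are the values of \<open>hopscotch_sum\<close> on and below the diagonal.\<close>
    using sum_hopscotch_enumeration[OF assms(4)[of i j], of "entry T"] ij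
    by (auto simp: path_weight_def hopscotch_sum_eq_0)
qed

end
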